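(* Let $v$ be a positive odd integer and $g,z$ positive integers. If there exists a $(v,g,z)$ non-half-sum disjoint packing (NHSDP), then there exists a $(v,g,b)$ non-half-sum Latin rectangle (NHSLR) with $b=gz$.
   Context: $\mathbb{Z}_v$ is the ring of integers modulo $v$; since $v$ is odd, $2$ is invertible in $\mathbb{Z}_v$, and the half-sum of $x,y\in\mathbb{Z}_v$ is $\frac{x+y}{2}\in\mathbb{Z}_v$. NHSDP. A pair $(\mathbb{Z}_v,\mathfrak{D})$, where $\mathfrak{D}$ consists of $z$ subsets (blocks) of $\mathbb{Z}_v$, each of size $g$, is a $(v,g,z)$ NHSDP if: (i) any two different blocks of $\mathfrak{D}$ are disjoint; (ii) for each block $\mathcal{D}\in\mathfrak{D}$, the half-sum of any two different elements of $\mathcal{D}$ does not belong to any block of $\mathfrak{D}$. NHSLR. A $g\times b$ array $\mathbf{D}$ with entries in $\mathbb{Z}_v$ is a $(v,g,b)$ NHSLR if: (i) each element of $\mathbb{Z}_v$ appears at most once in each row and at most once in each column of $\mathbf{D}$; (ii) for any two distinct rows $\mathbf{d},\mathbf{d}'$ of $\mathbf{D}$ (rows at two different row positions), no entry of the entrywise half-sum vector $\frac12(\mathbf{d}+\mathbf{d}')$ appears as an entry of $\mathbf{d}$ or of $\mathbf{d}'$. *)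

theory Defs
  imports "HOL-Number_Theory.Number_Theory"
begin

text \<open>
  The factor 1/2 is written with \<^const>\<open>modular_inverse\<close> rather than with the ring-theoretic
  inverse because for \<open>v = 1\<close> the unit of \<^const>\<open>residue_ring\<close> lies outside its carrier.
\<close>

definition half_sum :: "int \<Rightarrow> int \<Rightarrow> int \<Rightarrow> int" where
  "half_sum v x y =
     (x \<oplus>\<^bsub>residue_ring v\<^esub> y) \<otimes>\<^bsub>residue_ring v\<^esub> modular_inverse v 2"

lemma half_sum_in_carrier:
  assumes "v > 0"
  shows "half_sum v x y \<in> carrier (residue_ring v)"
  using assms by (simp add: half_sum_def residue_ring_def)

lemma half_sum_doubled:
  assumes "odd v"
  shows "half_sum v x y \<oplus>\<^bsub>residue_ring v\<^esub> half_sum v x y = x \<oplus>\<^bsub>residue_ring v\<^esub> y"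
proof -
  have "[2 * modular_inverse v 2 = 1] (mod v)"
    using assms by (intro cong_modular_inverse1) simp
  hence "[(x + y) * (2 * modular_inverse v 2) = (x + y) * 1] (mod v)"
    by (rule cong_scalar_left)
  hence "((x + y) * modular_inverse v 2 + (x + y) * modular_inverse v 2) mod v = (x + y) mod v"
    by (simp add: cong_def algebra_simps)
  thus ?thesis
    by (simp add: half_sum_def residue_ring_def mod_simps)
qed

definition NHSDP :: "int \<Rightarrow> nat \<Rightarrow> nat \<Rightarrow> int set set \<Rightarrow> bool" where
  "NHSDP v g z \<DD> \<longleftrightarrow>
     finite \<DD> \<and> card \<DD> = z \<and>
     (\<forall>B\<in>\<DD>. B \<subseteq> carrier (residue_ring v) \<and> finite B \<and> card B = g) \<and>
     (\<forall>B\<in>\<DD>. \<forall>C\<in>\<DD>. B \<noteq> C \<longrightarrow> B \<inter> C = {}) \<and>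
     (\<forall>B\<in>\<DD>. \<forall>x\<in>B. \<forall>y\<in>B. x \<noteq> y \<longrightarrow> (\<forall>C\<in>\<DD>. half_sum v x y \<notin> C))"

text \<open>
  A \<open>g \<times> b\<close> array is a function of a row index \<open>i < g\<close> and a column index \<open>j < b\<close>; its values
  outside this range are irrelevant.
\<close>

definition NHSLR :: "int \<Rightarrow> nat \<Rightarrow> nat \<Rightarrow> (nat \<Rightarrow> nat \<Rightarrow> int) \<Rightarrow> bool" where
  "NHSLR v g b D \<longleftrightarrow>
     (\<forall>i<g. \<forall>j<b. D i j \<in> carrier (residue_ring v)) \<and>
     (\<forall>i<g. inj_on (\<lambda>j. D i j) {..<b}) \<and>
     (\<forall>j<b. inj_on (\<lambda>i. D i j) {..<g}) \<and>
     (\<forall>i<g. \<forall>i'<g. i \<noteq> i' \<longrightarrow>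
        (\<forall>j<b. \<forall>k<b. half_sum v (D i j) (D i' j) \<noteq> D i k \<and>
                       half_sum v (D i j) (D i' j) \<noteq> D i' k))"

end

(*
  Write the circulant Latin square of each block and put the squares side by side. Every row then
  runs once through the union of the blocks, and every column stays inside a single block.
*)
theory Submission
  imports Defs
begin

text \<open>Two entries of one column in different rows are different elements of a single block, so
  the packing keeps their half-sum out of every block. Every entry of the array lies in some block,
  hence no half-sum is an entry at all. The Latin conditions come from the cyclic shifts inside a
  square and the disjointness of the blocks across squares.\<close>

theorem theorem2:
  fixes v :: int and g z :: nat
  assumes "v > 0" and "odd v" and "g > 0" and "z > 0"
    and "\<exists>\<DD>. NHSDP v g z \<DD>"
  shows "\<exists>D. NHSLR v g (g * z) D"
proof -
  from assms(5) obtain \<DD> where "NHSDP v g z \<DD>" ..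
  then have fin: "finite \<DD>" and card: "card \<DD> = z"
    and block: "\<And>B. B \<in> \<DD> \<Longrightarrow> B \<subseteq> carrier (residue_ring v) \<and> finite B \<and> card B = g"
    and disj: "\<And>B C. B \<in> \<DD> \<Longrightarrow> C \<in> \<DD> \<Longrightarrow> B \<noteq> C \<Longrightarrow> B \<inter> C = {}"
    and nhs: "\<And>B C x y. B \<in> \<DD> \<Longrightarrow> C \<in> \<DD> \<Longrightarrow> x \<in> B \<Longrightarrow> y \<in> B \<Longrightarrow> x \<noteq> y \<Longrightarrow> half_sum v x y \<notin> C"
    by (simp_all add: NHSDP_def)
  obtain f where f: "bij_betw f {0..<z} \<DD>"
    using ex_bij_betw_nat_finite[OF fin] card by auto
  have "\<forall>B\<in>\<DD>. \<exists>e. bij_betw e {0..<g} B"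
    using block ex_bij_betw_nat_finite by metis
  then obtain e where e: "\<And>B. B \<in> \<DD> \<Longrightarrow> bij_betw (e B) {0..<g} B"
    by metis
  \<comment> \<open>Column \<open>j\<close> is column \<open>j mod g\<close> of square
    \<open>j div g\<close>; the reduction of \<open>j\<close> is absorbed by the outer
    \<open>mod g\<close>.\<close>
  define D where "D i j = e (f (j div g)) ((i + j) mod g)" for i j :: nat
  have f_in: "f (j div g) \<in> \<DD>" if "j < g * z" for j
    using that bij_betwE[OF f] by (simp add: less_mult_imp_div_less mult.commute)
  have D_in: "D i j \<in> f (j div g)" if "j < g * z" for i j
    using bij_betwE[OF e[OF f_in[OF that]]] \<open>g > 0\<close> by (simp add: D_def)
  have e_eq: "m = n" if "j < g * z" "e (f (j div g)) m = e (f (j div g)) n" "m < g" "n < g" for j m n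
    using bij_betw_imp_inj_on[OF e[OF f_in[OF that(1)]]] that
    by (simp add: inj_on_eq_iff)
  have row: "inj_on (D i) {..<g * z}" for i
  proof (rule inj_onI)
    fix j k assume "j \<in> {..<g * z}" "k \<in> {..<g * z}" and eq: "D i j = D i k"
    then have jk: "j < g * z" "k < g * z" by auto
    \<comment> \<open>The common entry lies in both blocks, so they cannot be disjoint.\<close>
    have "f (j div g) = f (k div g)"
      using disj[OF f_in f_in] jk D_in[OF jk(1), of i] D_in[OF jk(2), of i] eq by auto
    then have div_eq: "j div g = k div g"
      using inj_onD[OF bij_betw_imp_inj_on[OF f]] jk
      by (simp add: less_mult_imp_div_less mult.commute)
    then have "(i + j) mod g = (i + k) mod g"
      using e_eq[OF jk(1)] eq \<open>g > 0\<close> by (simp add: D_def)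
    \<comment> \<open>Cancelling the shift \<open>i\<close> leaves equal remainders, which together
      with the equal quotients determine the column.\<close>
    then have "j mod g = k mod g"
      using cong_add_lcancel_nat[of i j k g] by (simp add: cong_def)
    with div_eq show "j = k"
      by (metis div_mult_mod_eq)
  qed
  have col: "i = i'" if "j < g * z" "i < g" "i' < g" "D i j = D i' j" for i i' j
  proof -
    have "(i + j) mod g = (i' + j) mod g"
      using e_eq[OF that(1)] that(4) \<open>g > 0\<close> by (simp add: D_def)
    then have "i mod g = i' mod g"
      using cong_add_rcancel_nat[of i j i' g] by (simp add: cong_def)
    with that show ?thesis by simp
  qed
  \<comment> \<open>Leaving the row \<open>l\<close> free covers both \<open>D i k\<close> and
    \<open>D i' k\<close> at once.\<close>
  have "half_sum v (D i j) (D i' j) \<noteq> D l k"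
    if "i < g" "i' < g" "i \<noteq> i'" "j < g * z" "k < g * z" for i i' j k l
  proof -
    have "D i j \<noteq> D i' j"
      using col that by blast
    then have "half_sum v (D i j) (D i' j) \<notin> f (k div g)"
      using nhs[OF f_in f_in D_in D_in] that by blast
    with D_in[OF that(5)] show ?thesis by metis
  qed
  moreover have "D i j \<in> carrier (residue_ring v)" if "j < g * z" for i j
    using block[OF f_in[OF that]] D_in[OF that] by blast
  ultimately have "NHSLR v g (g * z) D"
    unfolding NHSLR_def inj_on_def[of _ "{..<g}"] using row col by simp
  then show ?thesis by blast
qed

end
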